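(* Let $T$ be a tree on $n\ge 3$ vertices with diameter $d$. Then the peak location of the sequence of normalized coefficients $d_0(T),d_1(T),\dots,d_{n-2}(T)$ is at least $\left\lfloor\frac{n-2}{1+d}\right\rfloor$.
   Context: A tree is a finite simple undirected connected graph without cycles; its diameter $d$ is the number of edges in a longest path in the tree. The distance matrix $\mathcal{D}(T)$ is indexed by the vertices of $T$, with $(i,j)$-entry equal to the length of a shortest path between $v_i$ and $v_j$. $\delta_k(T)$ denotes the coefficient of $x^k$ in $\det(\mathcal{D}(T)-xI)$, and for $0\le k\le n-2$ the normalized coefficients are $d_k(T)=\frac{1}{2^{n-2}}2^k|\delta_k(T)|$ (not to be confused with the diameter $d$). A sequence $a_0,\dots,a_m$ of real numbers is unimodal if there is a $k$ such that $a_{i-1}\le a_i$ for $i\le k$ and $a_i\ge a_{i+1}$ for $i\ge k$ (for all indices for which these make sense). The sequence $d_0(T),\dots,d_{n-2}(T)$ is unimodal for every tree $T$. A peak location of a unimodal sequence is such an index $k$, equivalently an index at which the maximum of the sequence is attained; "the peak location is at least $j$" means that every such $k$ satisfies $k\ge j$. *)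

theory Defs
  imports "Graph_Theory.Digraph_Component" "Jordan_Normal_Form.Determinant"
begin

text \<open>A finite simple undirected graph is the locale \<^locale>\<open>graph\<close>: a finite symmetric digraph
  without loops or parallel arcs, in which an edge is a pair of opposite arcs. Traversing an edge
  back and forth then counts as a \<^const>\<open>pre_digraph.cycle\<close> of length 2, so
  \<^const>\<open>forest\<close> and \<^const>\<open>tree\<close> do not apply; the cycles of the undirected
  graph are those of length at least 3. A path is a \<^const>\<open>pre_digraph.apath\<close> (no repeated
  vertex), and the length of its arc list is its number of edges.\<close>

definition undirected_tree :: "('a, 'b) pre_digraph \<Rightarrow> bool" where
  "undirected_tree T \<longleftrightarrow> graph T \<and> Digraph_Component.connected T \<and>
     \<not> (\<exists>p. pre_digraph.cycle T p \<and> length p \<ge> 3)"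

definition path_dist :: "('a, 'b) pre_digraph \<Rightarrow> 'a \<Rightarrow> 'a \<Rightarrow> nat" where
  "path_dist T u v = (LEAST l. \<exists>p. pre_digraph.apath T u p v \<and> length p = l)"

definition longest_path_diameter :: "('a, 'b) pre_digraph \<Rightarrow> nat" where
  "longest_path_diameter T = Max {length p | u p v. pre_digraph.apath T u p v}"

text \<open>The list \<open>vs\<close> enumerates the vertices and thereby orders the rows and columns.\<close>

definition distance_matrix :: "('a, 'b) pre_digraph \<Rightarrow> 'a list \<Rightarrow> real mat" where
  "distance_matrix T vs =
     mat (length vs) (length vs) (\<lambda>(i, j). real (path_dist T (vs ! i) (vs ! j)))"

text \<open>The determinant of \<open>D - x I\<close> over the polynomial ring; this differs from
  \<open>char_poly\<close>, which is the determinant of \<open>x I - D\<close>, by a sign.\<close>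

definition distance_char_poly :: "('a, 'b) pre_digraph \<Rightarrow> 'a list \<Rightarrow> real poly" where
  "distance_char_poly T vs =
     det (map_mat (\<lambda>a. [:a:]) (distance_matrix T vs) - [:0, 1:] \<cdot>\<^sub>m 1\<^sub>m (length vs))"

definition dist_coeff :: "('a, 'b) pre_digraph \<Rightarrow> 'a list \<Rightarrow> nat \<Rightarrow> real" where
  "dist_coeff T vs k = coeff (distance_char_poly T vs) k"

definition normalized_coeff :: "('a, 'b) pre_digraph \<Rightarrow> 'a list \<Rightarrow> nat \<Rightarrow> real" where
  "normalized_coeff T vs k = 1 / 2 ^ (length vs - 2) * 2 ^ k * \<bar>dist_coeff T vs k\<bar>"

text \<open>\<open>k\<close> witnesses that the finite sequence \<open>a 0, \<dots>, a m\<close> is unimodal.\<close>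

definition peak_location :: "(nat \<Rightarrow> real) \<Rightarrow> nat \<Rightarrow> nat \<Rightarrow> bool" where
  "peak_location a m k \<longleftrightarrow> k \<le> m \<and>
     (\<forall>i. 1 \<le> i \<and> i \<le> k \<longrightarrow> a (i - 1) \<le> a i) \<and>
     (\<forall>i. k \<le> i \<and> i + 1 \<le> m \<longrightarrow> a i \<ge> a (i + 1))"

end

theory Submission
  imports Defs "Jordan_Normal_Form.Schur_Decomposition"
begin

text \<open>The quadratic form of the distance matrix of a tree is negative definite on vectors of sum zero:
  a tree grows by adding leaves, and each new leaf contributes minus a square. As the trace is zero, the spectrum therefore consists of one
  positive eigenvalue \<open>l\<close> and \<open>n - 1\<close> negative ones \<open>- m\<^sub>i\<close> with \<open>l = \<Sum> m\<^sub>i\<close>, and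
  \<open>l \<le> n d\<close>. Hence all \<open>b\<^sub>k = \<bar>\<delta>\<^sub>k\<bar>\<close> with \<open>k \<le> n - 2\<close> are positive, and
  \<open>3 b\<^sub>n\<^sub>-\<^sub>3 \<le> 2 l b\<^sub>n\<^sub>-\<^sub>2\<close>. Newton's inequalities carry this ratio down to
  \<open>b\<^sub>k (n - 2) (n - k) \<le> 2 l (k + 1) b\<^sub>k\<^sub>+\<^sub>1\<close>, which gives \<open>b\<^sub>k < 2 b\<^sub>k\<^sub>+\<^sub>1\<close>, that is
  \<open>d\<^sub>k < d\<^sub>k\<^sub>+\<^sub>1\<close>, as long as \<open>(k + 1) (d + 1) \<le> n - 2\<close>.\<close>

section \<open>Newton's inequalities for real-rooted polynomials\<close>

definition real_rooted :: "complex poly \<Rightarrow> bool" where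
  "real_rooted p \<longleftrightarrow> p = 0 \<or> (\<forall>z. poly p z = 0 \<longrightarrow> z \<in> \<real>)"

text \<open>Subtracting a real number keeps \<open>z\<close> in its open half-plane and inversion
  moves it to the opposite one.\<close>

lemma Im_inverse_diff_real:
  assumes "r \<in> \<real>" "Im z \<noteq> 0"
  shows "Im z * Im (1 / (z - r)) < 0"
proof -
  have "Im r = 0" using assms(1) by (simp add: complex_is_Real_iff)
  then have "Im z * Im (1 / (z - r)) = - (Im z)\<^sup>2 / ((Re z - Re r)\<^sup>2 + (Im z)\<^sup>2)"
    by (simp add: Im_divide power2_eq_square)
  also have "\<dots> < 0"
    using assms(2) by (simp add: divide_neg_pos add_nonneg_pos)
  finally show ?thesis .
qed

text \<open>The logarithmic derivative, multiplied out. A nonreal \<open>z\<close> is none of the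
  real roots, so every summand is a genuine quotient.\<close>

lemma pderiv_prod_list_logarithmic:
  fixes z :: complex
  assumes "\<forall>r\<in>set rs. r \<in> \<real>" "Im z \<noteq> 0"
  shows "poly (pderiv (\<Prod>r\<leftarrow>rs. [:-r, 1:])) z
    = poly (\<Prod>r\<leftarrow>rs. [:-r, 1:]) z * (\<Sum>r\<leftarrow>rs. 1 / (z - r))"
  using assms(1)
proof (induction rs)
  case (Cons r rs)
  have "z \<noteq> r" using Cons.prems assms(2) by (auto simp: complex_is_Real_iff)
  moreover have "pderiv [:-r, 1:] = 1" by (simp add: pderiv_pCons)
  ultimately show ?case using Cons
    by (simp add: pderiv_mult pderiv_pCons field_simps del: mult_pCons_left mult_pCons_right)
qed simp

lemma Im_sum_list_inverse_diff_real:
  assumes "\<forall>r\<in>set rs. r \<in> \<real>" "Im z \<noteq> 0" "rs \<noteq> []"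
  shows "Im z * Im (\<Sum>r\<leftarrow>rs. 1 / (z - r)) < 0"
  using assms(1,3)
proof (induction rs)
  case (Cons r rs)
  have "Im z * Im (1 / (z - r)) < 0"
    using Cons.prems assms(2) by (intro Im_inverse_diff_real) auto
  moreover have "Im z * Im (\<Sum>r\<leftarrow>rs. 1 / (z - r)) \<le> 0"
    using Cons by (cases "rs = []") auto
  ultimately show ?case by (simp add: algebra_simps)
qed simp

text \<open>Gauss-Lucas for the real line: at a nonreal \<open>z\<close> all summands of
  \<open>p'/p\<close> lie in the half-plane opposite to that of \<open>z\<close>, so they cannot add
  up to zero.\<close>

lemma real_rooted_pderiv:
  assumes "real_rooted p"
  shows "real_rooted (pderiv p)"
proof (cases "pderiv p = 0")
  case False
  then have p0: "p \<noteq> 0" by auto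
  obtain rs where p: "p = smult (lead_coeff p) (\<Prod>r\<leftarrow>rs. [:-r, 1:])"
    using fundamental_theorem_algebra_factorized[of p] by metis
  let ?q = "\<Prod>r\<leftarrow>rs. [:-r, 1:]"
  have root: "poly p z = 0 \<longleftrightarrow> z \<in> set rs" for z
    by (subst p) (use p0 in \<open>simp add: poly_prod_list prod_list_zero_iff image_iff\<close>)
  have rs: "\<forall>r\<in>set rs. r \<in> \<real>" 
    using assms p0 root unfolding real_rooted_def by auto
  \<comment> \<open>A constant would have derivative zero; with at least one root the sum of the
    imaginary parts is strictly of one sign.\<close>
  have "rs \<noteq> []" using False by (subst (asm) p) auto
  have "z \<in> \<real>" if z: "poly (pderiv p) z = 0" for z
  proof (rule ccontr)
    assume "z \<notin> \<real>"
    then have Im: "Im z \<noteq> 0" by (simp add: complex_is_Real_iff)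
    have "poly ?q z \<noteq> 0"
      using rs \<open>z \<notin> \<real>\<close> by (auto simp: poly_prod_list prod_list_zero_iff)
    moreover have "poly (pderiv ?q) z = 0"
      using z p0 by (subst (asm) p) (simp add: pderiv_smult)
    ultimately have "(\<Sum>r\<leftarrow>rs. 1 / (z - r)) = 0"
      using pderiv_prod_list_logarithmic[OF rs Im] by simp
    then show False
      using Im_sum_list_inverse_diff_real[OF rs Im \<open>rs \<noteq> []\<close>] by simp
  qed
  then show ?thesis unfolding real_rooted_def by simp
qed (simp add: real_rooted_def)

lemma real_rooted_higher_pderiv: "real_rooted p \<Longrightarrow> real_rooted ((pderiv ^^ k) p)"
  by (induction k) (auto intro: real_rooted_pderiv)

text \<open>The roots of the reflection are reciprocals of roots of \<open>p\<close>; zero is not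
  among them, since the value there is the leading coefficient of \<open>p\<close>.\<close>

lemma real_rooted_reflect_poly:
  assumes "real_rooted p"
  shows "real_rooted (reflect_poly p)"
proof (cases "p = 0")
  case False
  have "z \<in> \<real>" if z: "poly (reflect_poly p) z = 0" for z
  proof -
    have "z \<noteq> 0" using z False by auto
    then have "poly p (inverse z) = 0"
      using z by (simp add: poly_reflect_poly_nz)
    then have "inverse z \<in> \<real>" using assms False unfolding real_rooted_def by auto
    then show ?thesis by (metis Reals_inverse inverse_inverse_eq)
  qed
  then show ?thesis unfolding real_rooted_def by simp
qed (simp add: real_rooted_def)

text \<open>With a negative discriminant, the quadratic formula yields the nonreal root
  \<open>z\<close>.\<close>

lemma real_rooted_quadratic:
  fixes a b c :: real
  assumes "real_rooted [:of_real c, of_real b, of_real a:]"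
  shows "4 * a * c \<le> b\<^sup>2"
proof (rule ccontr)
  assume "\<not> ?thesis"
  then have disc: "b\<^sup>2 < 4 * a * c" by simp
  then have a: "a \<noteq> 0" by (metis mult_zero_left mult_zero_right not_less zero_le_power2)
  define s where "s = sqrt (4 * a * c - b\<^sup>2)"
  have s: "s > 0" "s\<^sup>2 = 4 * a * c - b\<^sup>2" using disc by (auto simp: s_def)
  define z where "z = Complex (- b / (2 * a)) (s / (2 * a))"
  have "poly [:of_real c, of_real b, of_real a:] z = 0"
  proof -
    have "2 * a * a * (b * b + s * s) = 2 * a * a * (4 * a * c)"
      using s(2) by (simp add: power2_eq_square)
    then show ?thesis
      using a by (simp add: z_def complex_eq_iff field_simps)
  qed
  moreover have "z \<notin> \<real>" using s(1) a by (simp add: z_def complex_is_Real_iff)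
  ultimately show False using assms a unfolding real_rooted_def by auto
qed

text \<open>Differentiating \<open>k - 1\<close> times, reflecting and differentiating again leaves
  a real-rooted quadratic made of the coefficients \<open>k - 1\<close>, \<open>k\<close>,
  \<open>k + 1\<close>; the claim is that its discriminant is nonnegative.\<close>

lemma newton_inequality:
  fixes p :: "real poly"
  assumes "real_rooted (map_poly of_real p)" and k: "1 \<le> k" "k < degree p"
  shows "real (k + 1) * real (degree p - k + 1) * coeff p (k - 1) * coeff p (k + 1)
    \<le> real k * real (degree p - k) * (coeff p k)\<^sup>2"
proof -
  define P where "P = map_poly complex_of_real p"
  define q where "q = (pderiv ^^ (k - 1)) P"
  \<comment> \<open>The first round of derivatives leaves degree \<open>m + 2\<close>, so
    \<open>m\<close> further ones bring the reflection down to a quadratic.\<close>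
  define m where "m = degree p - k - 1"
  have deg: "degree p = m + k + 1" using k m_def by auto
  obtain j where j: "k = Suc j" using k by (cases k) auto
  define r where "r = (pderiv ^^ m) (reflect_poly q)"
  have degP: "degree P = degree p" by (simp add: P_def)
  have degq: "degree q = m + 2"
    by (simp add: q_def degP degree_higher_pderiv deg j)
  have rr: "real_rooted r"
    unfolding r_def q_def
    by (intro real_rooted_higher_pderiv real_rooted_reflect_poly) (use assms P_def in simp)
  have coq: "coeff q i = of_real (pochhammer (real (Suc i)) j * coeff p (i + j))" for i
    using pochhammer_of_real[of "real (Suc i)" j, where 'a = complex]
    by (simp add: q_def j coeff_higher_pderiv P_def coeff_map_poly)
  have cor: "coeff r i = (if i > 2 then 0 else of_nat (pochhammer (Suc i) m) * coeff q (2 - i))" for i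
    by (simp add: r_def coeff_higher_pderiv coeff_reflect_poly degq pochhammer_of_nat flip: of_nat_Suc)
  \<comment> \<open>The reflection reverses the order: \<open>c\<close> carries the coefficient
    \<open>k + 1\<close> of \<open>p\<close> and \<open>a\<close> the coefficient
    \<open>k - 1\<close>.\<close>
  define c b a where 
    "c = real (pochhammer 1 m) * (pochhammer 3 j * coeff p (Suc (Suc j)))"
    "b = real (pochhammer 2 m) * (pochhammer 2 j * coeff p (Suc j))"
    "a = real (pochhammer 3 m) * (pochhammer 1 j * coeff p j)"
  have "r = [:of_real c, of_real b, of_real a:]"
    by (rule poly_eqI)
      (auto simp: cor coq coeff_pCons c_b_a_def numeral_eq_Suc pochhammer_of_real split: nat.splits)
  with rr have "4 * a * c \<le> b\<^sup>2" by (intro real_rooted_quadratic) auto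
  moreover have poch: "pochhammer (1 :: real) n = fact n"
    "pochhammer (2 :: real) n = real (n + 1) * fact n"
    "pochhammer (3 :: real) n = real (n + 1) * real (n + 2) * fact n / 2" for n
    by (induction n) (auto simp: pochhammer_Suc field_simps)
  have poch_nat: "real (pochhammer 1 m) = pochhammer 1 m" "real (pochhammer 2 m) = pochhammer 2 m"
    "real (pochhammer 3 m) = pochhammer 3 m"
    using pochhammer_of_nat[of 1 m, where 'a = real] pochhammer_of_nat[of 2 m, where 'a = real]
      pochhammer_of_nat[of 3 m, where 'a = real] by simp_all
  note cba = c_b_a_def[unfolded poch_nat poch]
  \<comment> \<open>The positive factor common to \<open>4 * a * c\<close> and \<open>b * b\<close>,
    to be cancelled.\<close>
  define w where "w = real (m + 1) * real (j + 1) * (fact m * fact j :: real)\<^sup>2"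
  have w: "w > 0" by (simp add: w_def)
  have "4 * a * c = w * (real (m + 2) * real (j + 2) * coeff p j * coeff p (Suc (Suc j)))"
    by (simp add: cba w_def power2_eq_square)
  moreover have "b\<^sup>2 = w * (real (m + 1) * real (j + 1) * (coeff p (Suc j))\<^sup>2)"
    by (simp add: cba w_def power2_eq_square)
  ultimately have "real (m + 2) * real (j + 2) * coeff p j * coeff p (Suc (Suc j))
      \<le> real (m + 1) * real (j + 1) * (coeff p (Suc j))\<^sup>2"
    using w by (simp add: mult_le_cancel_left_pos)
  then show ?thesis
    using deg j by (simp add: algebra_simps)
qed

lemma map_poly_of_real_prod_list_linear:
  "map_poly complex_of_real (\<Prod>e\<leftarrow>es. [:- e, 1:]) = (\<Prod>e\<leftarrow>es. [:- of_real e, 1:])"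
proof (induction es)
  case (Cons e es)
  interpret map_poly_comm_ring_hom complex_of_real ..
  have "map_poly complex_of_real [:- e, 1:] = [:- of_real e, 1:]" by simp
  then show ?case using Cons by (simp add: hom_mult del: mult_pCons_left mult_pCons_right)
qed simp

lemma real_rooted_prod_list_linear:
  "real_rooted (map_poly complex_of_real (\<Prod>e\<leftarrow>es. [:- e, 1:]))"
  unfolding real_rooted_def map_poly_of_real_prod_list_linear
  by (auto simp: poly_prod_list prod_list_zero_iff)

section \<open>Polynomials with one dominant root\<close>

text \<open>The generating function of the elementary symmetric polynomials: its coefficient
  \<open>s\<close> is \<open>e_s\<close> evaluated at \<open>ms\<close>.\<close>

abbreviation esym_poly :: "real list \<Rightarrow> real poly" where
  "esym_poly ms \<equiv> \<Prod>m\<leftarrow>ms. [:1, m:]"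

lemma coeff_esym_poly_Cons:
  "coeff (esym_poly (m # ms)) 0 = coeff (esym_poly ms) 0"
  "coeff (esym_poly (m # ms)) (Suc s) = coeff (esym_poly ms) (Suc s) + m * coeff (esym_poly ms) s"
  by simp_all

lemma coeff_esym_poly_0: "coeff (esym_poly ms) 0 = 1"
  by (induction ms) simp_all

lemma coeff_esym_poly_1: "coeff (esym_poly ms) 1 = sum_list ms"
  by (induction ms) (simp_all add: coeff_esym_poly_0)

lemma coeff_esym_poly_nonneg: "\<forall>m\<in>set ms. 0 < m \<Longrightarrow> 0 \<le> coeff (esym_poly ms) s"
proof (induction ms arbitrary: s)
  case (Cons m ms)
  then show ?case by (cases s) (simp_all add: coeff_esym_poly_0)
qed simp

lemma coeff_esym_poly_pos:
  "\<lbrakk>\<forall>m\<in>set ms. 0 < m; s \<le> length ms\<rbrakk> \<Longrightarrow> 0 < coeff (esym_poly ms) s"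
proof (induction ms arbitrary: s)
  case (Cons m ms)
  then show ?case
    using coeff_esym_poly_nonneg[of ms s]
    by (cases s) (auto intro!: add_nonneg_pos simp: coeff_esym_poly_0)
qed simp

text \<open>Every monomial of \<open>e_(s+1)\<close> occurs in the expansion of
  \<open>e_1 * e_s\<close>, and the other terms there are nonnegative.\<close>

lemma coeff_esym_poly_Suc_le:
  assumes "\<forall>m\<in>set ms. 0 < m"
  shows "coeff (esym_poly ms) (Suc s) \<le> sum_list ms * coeff (esym_poly ms) s"
  using assms
proof (induction ms arbitrary: s)
  case (Cons m ms)
  have nn: "0 \<le> coeff (esym_poly ms) t" for t
    using Cons.prems by (intro coeff_esym_poly_nonneg) auto
  have sn: "0 \<le> sum_list ms" using Cons.prems by (intro sum_list_nonneg) auto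
  show ?case
  proof (cases s)
    case 0
    then show ?thesis using coeff_esym_poly_1[of "m # ms"] by (simp add: coeff_esym_poly_0)
  next
    case (Suc t)
    have "coeff (esym_poly ms) (Suc s) \<le> sum_list ms * coeff (esym_poly ms) s"
      using Cons by simp
    moreover have "0 \<le> m * (m * coeff (esym_poly ms) t)" "0 \<le> m * (sum_list ms * coeff (esym_poly ms) t)"
      using nn[of t] sn Cons.prems by auto
    ultimately show ?thesis
      unfolding coeff_esym_poly_Cons Suc by (simp add: algebra_simps)
  qed
qed simp

text \<open>For \<open>s\<close> at least 1 the product \<open>e_1 * e_s\<close> also contains
  monomials with a squared factor, which are positive. For \<open>s = 0\<close> equality would
  hold.\<close>

lemma coeff_esym_poly_Suc_less:
  assumes "\<forall>m\<in>set ms. 0 < m" "1 \<le> s" "s \<le> length ms"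
  shows "coeff (esym_poly ms) (Suc s) < sum_list ms * coeff (esym_poly ms) s"
proof -
  obtain m ks where ms: "ms = m # ks" using assms by (cases ms) auto
  obtain t where s: "s = Suc t" using assms by (cases s) auto
  have "0 < m * (m * coeff (esym_poly ks) t)"
    using assms coeff_esym_poly_pos[of ks t] by (simp add: ms s)
  moreover have "0 \<le> m * (sum_list ks * coeff (esym_poly ks) t)"
    using assms coeff_esym_poly_nonneg[of ks t] sum_list_nonneg[of ks]
    by (intro mult_nonneg_nonneg) (auto simp: ms less_imp_le)
  moreover have "coeff (esym_poly ks) (Suc s) \<le> sum_list ks * coeff (esym_poly ks) s"
    using assms by (intro coeff_esym_poly_Suc_le) (simp add: ms)
  ultimately show ?thesis
    unfolding ms coeff_esym_poly_Cons s by (simp add: algebra_simps)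
qed

text \<open>The difference of the two sides is the sum of the squares of \<open>ms\<close>.\<close>

lemma esym_power_sum_2_nonneg:
  "2 * coeff (esym_poly ms) 2 \<le> (sum_list ms)\<^sup>2"
proof (induction ms)
  case (Cons m ms)
  then show ?case
    using coeff_esym_poly_1[of ms] zero_le_square[of m]
    unfolding coeff_esym_poly_Cons numeral_2_eq_2
    by (simp add: power2_eq_square algebra_simps del: zero_le_square)
qed simp

text \<open>By Newton's identity the difference of the two sides is the sum of the cubes of
  \<open>ms\<close>.\<close>

lemma esym_power_sum_3_nonneg:
  assumes "\<forall>m\<in>set ms. 0 < m"
  shows "3 * (sum_list ms * coeff (esym_poly ms) 2 - coeff (esym_poly ms) 3) \<le> sum_list ms ^ 3"
  using assms
proof (induction ms)
  case (Cons m ms)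
  have m: "0 \<le> m * (m * m)" using Cons.prems by simp
  show ?case
    using Cons coeff_esym_poly_1[of ms]
    unfolding coeff_esym_poly_Cons numeral_2_eq_2 numeral_3_eq_3
    by (simp add: power2_eq_square power3_eq_cube algebra_simps) (use m in linarith)
qed simp

text \<open>The left side is at most \<open>l * l * l\<close> by the cubes, and so is
  \<open>2 * l * e_2\<close> by the squares. In terms of the characteristic polynomial this compares
  the coefficients of index \<open>n - 3\<close> and \<open>n - 2\<close>.\<close>

lemma esym_bottom_ratio:
  assumes "\<forall>m\<in>set ms. 0 < m"
  defines "l \<equiv> sum_list ms"
  shows "3 * (l * coeff (esym_poly ms) 2 - coeff (esym_poly ms) 3)
    \<le> 2 * l * (l * l - coeff (esym_poly ms) 2)"
proof -
  have "0 \<le> l" unfolding l_def using assms by (intro sum_list_nonneg) auto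
  then have "l * (2 * coeff (esym_poly ms) 2) \<le> l * l\<^sup>2"
    using esym_power_sum_2_nonneg[of ms] unfolding l_def by (intro mult_left_mono) auto
  then show ?thesis
    using esym_power_sum_3_nonneg[OF assms(1)] unfolding l_def[symmetric]
    by (simp add: power2_eq_square power3_eq_cube algebra_simps)
qed

lemma reflect_poly_prod_list_linear:
  "reflect_poly (\<Prod>r\<leftarrow>rs. [:- r, 1:]) = esym_poly (map uminus rs)" for rs :: "real list"
proof (induction rs)
  case (Cons r rs)
  have "reflect_poly [:- r, 1:] = [:1, - r:]"
    by (intro poly_eqI) (auto simp: coeff_reflect_poly coeff_pCons split: nat.splits)
  with Cons show ?case by (simp add: reflect_poly_mult del: mult_pCons_left mult_pCons_right)
qed simp

lemma degree_prod_list_linear: "degree (\<Prod>r\<leftarrow>rs. [:- r, 1:]) = length rs" for rs :: "real list"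
proof (induction rs)
  case (Cons r rs)
  have "(\<Prod>r\<leftarrow>rs. [:- r, 1:]) \<noteq> 0" by (auto simp: prod_list_zero_iff)
  with Cons show ?case by (simp add: degree_mult_eq del: mult_pCons_left mult_pCons_right)
qed simp

text \<open>Reflection turns the product into \<open>(1 - l * x)\<close> times
  \<open>esym_poly ms\<close>. As the degree is \<open>length ms + 1\<close>, the coefficient in
  question becomes number \<open>s + 1\<close>.\<close>

lemma coeff_dominant_root_poly:
  assumes "s \<le> length ms"
  shows "coeff (\<Prod>r\<leftarrow>l # map uminus ms. [:- r, 1:]) (length ms - s)
    = - (l * coeff (esym_poly ms) s - coeff (esym_poly ms) (Suc s))"
proof -
  let ?p = "\<Prod>r\<leftarrow>l # map uminus ms. [:- r, 1:]"
  have deg: "degree ?p = Suc (length ms)"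
    using degree_prod_list_linear[of "l # map uminus ms"] by simp
  have "coeff ?p (length ms - s) = coeff (reflect_poly ?p) (Suc s)"
    using assms unfolding coeff_reflect_poly deg by simp
  also have "reflect_poly ?p = esym_poly (- l # ms)"
    unfolding reflect_poly_prod_list_linear by (simp add: o_def)
  finally show ?thesis by simp
qed

lemma dominant_root_coeff_growth:
  fixes d :: nat
  assumes ms: "\<forall>m\<in>set ms. 0 < m" and l: "l = sum_list ms"
    and p: "p = (\<Prod>r\<leftarrow>l # map uminus ms. [:- r, 1:])"
    and n: "n = Suc (length ms)" "3 \<le> n" and bound: "l \<le> real n * real d"
    and j: "(j + 1) * (d + 1) \<le> n - 2"
  shows "\<bar>coeff p j\<bar> < 2 * \<bar>coeff p (j + 1)\<bar>"
proof -
  \<comment> \<open>Up to index \<open>n - 2\<close> all coefficients of \<open>p\<close> are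
    negative, so there \<open>b\<close> is their absolute value.\<close>
  define b where "b k = - coeff p k" for k
  have deg: "degree p = n" unfolding p n(1) degree_prod_list_linear by simp
  have b_eq: "b k = l * coeff (esym_poly ms) (n - 1 - k) - coeff (esym_poly ms) (Suc (n - 1 - k))"
    if "k \<le> n - 1" for k
    using coeff_dominant_root_poly[of "n - 1 - k" ms l] that unfolding b_def p n(1) by simp
  have pos: "0 < b k" if "k \<le> n - 2" for k
    using coeff_esym_poly_Suc_less[OF ms, of "n - 1 - k"] that n b_eq[of k] l by simp
  have lpos: "0 < l" unfolding l using ms n by (cases ms) (auto intro!: add_pos_nonneg sum_list_nonneg)
  have rr: "real_rooted (map_poly complex_of_real p)"
    unfolding p by (rule real_rooted_prod_list_linear)
  have newton: "real (k + 2) * real (n - k) * b k * b (k + 2)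
      \<le> real (k + 1) * real (n - k - 1) * (b (k + 1))\<^sup>2" if "k + 3 \<le> n" for k
    using newton_inequality[OF rr, of "k + 1"] that unfolding deg b_def
    by (simp add: Suc_diff_Suc)
  \<comment> \<open>The weights \<open>k + 1\<close> and \<open>n - k\<close> are those for which
    Newton's inequality passes the bound from \<open>k + 1\<close> to \<open>k\<close>; the constant
    \<open>n - 2\<close> makes \<open>k = n - 3\<close> the bottom ratio.\<close>
  have ratio: "b k * (real (n - 2) * real (n - k)) \<le> 2 * l * real (k + 1) * b (k + 1)" if "k \<le> n - 3" for k
    using that
  proof (induction k rule: inc_induct)
    case base
    have "coeff (esym_poly ms) 1 = l" using coeff_esym_poly_1 l by simp
    moreover have "n - 1 - (n - 3) = 2" "n - 1 - (n - 2) = 1" using n(2) by auto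
    then have "b (n - 3) = l * coeff (esym_poly ms) 2 - coeff (esym_poly ms) 3"
      "b (n - 2) = l * coeff (esym_poly ms) 1 - coeff (esym_poly ms) 2"
      using b_eq[of "n - 3"] b_eq[of "n - 2"] by (simp_all add: numeral_2_eq_2 numeral_3_eq_3)
    ultimately have "3 * b (n - 3) \<le> 2 * l * b (n - 2)"
      using esym_bottom_ratio[OF ms] l by simp
    then have "real (n - 2) * (3 * b (n - 3)) \<le> real (n - 2) * (2 * l * b (n - 2))"
      by (intro mult_left_mono) auto
    moreover have "n - 3 + 1 = n - 2" "n - (n - 3) = 3" using n by auto
    ultimately show ?case by (simp only: mult_ac of_nat_numeral)
  next
    case (step k)
    from step.hyps n(2) have k: "k + 3 \<le> n" "k < n - 3" by linarith+
    have bk: "0 < b k" "0 < b (k + 1)" using pos k by auto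
    \<comment> \<open>The claim is multiplied by a positive factor so that the induction hypothesis
      and then Newton's inequality apply; the factor is cancelled at the end.\<close>
    have "b (k + 1) * real (n - k - 1) * (b k * (real (n - 2) * real (n - k)))
        = (b (Suc k) * (real (n - 2) * real (n - Suc k))) * (b k * real (n - k))"
      by simp
    also have "\<dots> \<le> (2 * l * real (Suc k + 1) * b (Suc k + 1)) * (b k * real (n - k))"
      using step.IH bk by (intro mult_right_mono) auto
    also have "\<dots> = 2 * l * (real (k + 2) * real (n - k) * b k * b (k + 2))" by simp
    also have "\<dots> \<le> 2 * l * (real (k + 1) * real (n - k - 1) * (b (k + 1))\<^sup>2)"
      using newton[OF k(1)] lpos by (intro mult_left_mono) auto
    also have "\<dots> = b (k + 1) * real (n - k - 1) * (2 * l * real (k + 1) * b (k + 1))"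
      by (simp add: power2_eq_square)
    finally show ?case
      by (rule mult_left_le_imp_le) (use bk k in auto)
  qed
  have jn: "j + 3 \<le> n" and jd: "(j + 1) * d + j + 3 \<le> n"
    using j n(2) by (auto simp: algebra_simps)
  have bj: "0 < b j" "0 < b (j + 1)" using pos jn by auto
  have "b j * (real (n - 2) * real (n - j)) \<le> 2 * l * real (j + 1) * b (j + 1)"
    using jn by (intro ratio) simp
  also have "\<dots> = l * (2 * real (j + 1) * b (j + 1))" by (simp only: mult_ac)
  also have "\<dots> \<le> real n * real d * (2 * real (j + 1) * b (j + 1))"
    using bound bj by (intro mult_right_mono) auto
  also have "\<dots> = real (n * ((j + 1) * d)) * (2 * b (j + 1))"
    by (simp add: algebra_simps)
  also have "\<dots> < real (n - 2) * real (n - j) * (2 * b (j + 1))"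
  proof (rule mult_strict_right_mono)
    \<comment> \<open>The following strict inequality has slack \<open>n + 2 * j\<close>.\<close>
    have "n * ((j + 1) * d) \<le> n * (n - 3 - j)" using jd by (intro mult_left_mono) auto
    also have "\<dots> < (n - 2) * (n - j)"
    proof -
      obtain i where "n = i + j + 3" using jn by (metis add.commute add.left_commute le_Suc_ex)
      then show ?thesis by (simp add: algebra_simps)
    qed
    finally show "real (n * ((j + 1) * d)) < real (n - 2) * real (n - j)"
      by (simp only: of_nat_mult[symmetric] of_nat_less_iff)
  qed (use bj in simp)
  finally have "real (n - 2) * real (n - j) * b j < real (n - 2) * real (n - j) * (2 * b (j + 1))"
    by (simp only: mult_ac)
  then have "b j < 2 * b (j + 1)" by (rule mult_left_less_imp_less) simp
  moreover have "\<bar>coeff p j\<bar> = b j" "\<bar>coeff p (j + 1)\<bar> = b (j + 1)" using bj by (auto simp: b_def)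
  ultimately show ?thesis by simp
qed

section \<open>Spectra of symmetric matrices\<close>

text \<open>A complex root \<open>a\<close> has an eigenvector \<open>v\<close>. The Hermitian form
  \<open>X\<close> of \<open>A\<close> at \<open>v\<close> is real by symmetry and equals
  \<open>a * N\<close>, with \<open>N\<close> the positive squared norm, so \<open>a\<close> is
  real.\<close>

lemma char_poly_symmetric_splits:
  fixes A :: "real mat"
  assumes A: "A \<in> carrier_mat n n" and sym: "\<And>i j. \<lbrakk>i < n; j < n\<rbrakk> \<Longrightarrow> A $$ (i, j) = A $$ (j, i)"
  obtains es where "char_poly A = (\<Prod>e\<leftarrow>es. [:- e, 1:])" "length es = n"
proof -
  let ?A = "map_mat complex_of_real A"
  have cA: "?A \<in> carrier_mat n n" using A by simp
  obtain as where as: "char_poly ?A = (\<Prod>a\<leftarrow>as. [:- a, 1:])" "length as = n"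
    using char_poly_factorized[OF cA] by auto
  have real: "a \<in> \<real>" if "a \<in> set as" for a
  proof -
    have "poly (char_poly ?A) a = 0"
      using that by (auto simp: as poly_prod_list prod_list_zero_iff)
    then obtain v where v: "v \<in> carrier_vec n" "v \<noteq> 0\<^sub>v n" "?A *\<^sub>v v = a \<cdot>\<^sub>v v"
      using eigenvalue_root_char_poly[OF cA] cA unfolding eigenvalue_def eigenvector_def by auto
    define N where "N = (\<Sum>i<n. v $ i * cnj (v $ i))"
    define X where "X = (\<Sum>i<n. \<Sum>j<n. of_real (A $$ (i, j)) * v $ j * cnj (v $ i))"
    have row: "(\<Sum>j<n. of_real (A $$ (i, j)) * v $ j) = a * v $ i" if i: "i < n" for i
    proof -
      have "(?A *\<^sub>v v) $ i = (a \<cdot>\<^sub>v v) $ i" by (simp add: v)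
      then show ?thesis
        using i A v(1) by (simp add: scalar_prod_def atLeast0LessThan)
    qed
    have "X = a * N"
      unfolding X_def N_def sum_distrib_left
      by (intro sum.cong refl) (simp add: row flip: sum_distrib_right)
    moreover have "cnj X = X"
    proof -
      have "cnj X = (\<Sum>i<n. \<Sum>j<n. of_real (A $$ (j, i)) * v $ i * cnj (v $ j))"
        unfolding X_def cnj_sum
        by (intro sum.cong refl) (simp add: sym algebra_simps)
      also have "\<dots> = X" unfolding X_def by (rule sum.swap)
      finally show ?thesis .
    qed
    moreover have N: "N = of_real (\<Sum>i<n. (cmod (v $ i))\<^sup>2)"
      unfolding N_def of_real_sum complex_norm_square ..
    moreover have "N \<noteq> 0"
    proof
      assume "N = 0"
      then have "(\<Sum>i<n. (cmod (v $ i))\<^sup>2) = 0" unfolding N by (simp only: of_real_eq_0_iff)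
      then have "\<forall>i<n. v $ i = 0" by (simp add: sum_nonneg_eq_0_iff)
      then show False using v(1,2) by (auto intro!: eq_vecI)
    qed
    ultimately have "a = X / N" "X \<in> \<real>" "N \<in> \<real>" by (auto simp: Reals_cnj_iff)
    then show ?thesis by simp
  qed
  define es where "es = map Re as"
  have "map complex_of_real es = as"
    unfolding es_def map_map by (rule map_idI) (auto simp: real)
  then have "char_poly ?A = (\<Prod>e\<leftarrow>es. [:- of_real e, 1:])"
    unfolding as(1) by (metis (mono_tags, lifting) list.map_comp map_eq_conv comp_apply)
  also have "\<dots> = map_poly of_real (\<Prod>e\<leftarrow>es. [:- e, 1:])"
    by (rule map_poly_of_real_prod_list_linear[symmetric])
  finally have "map_poly complex_of_real (char_poly A) = map_poly of_real (\<Prod>e\<leftarrow>es. [:- e, 1:])"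
    by (simp add: of_real_hom.char_poly_hom[OF A])
  then have "char_poly A = (\<Prod>e\<leftarrow>es. [:- e, 1:])"
    by (simp add: poly_eq_iff coeff_map_poly)
  then show ?thesis by (rule that) (simp add: as(2) es_def)
qed

section \<open>Trace and eigenvectors\<close>

definition mat_trace :: "'a :: comm_ring_1 mat \<Rightarrow> 'a" where
  "mat_trace A = (\<Sum>i<dim_row A. A $$ (i, i))"

lemma mat_trace_mult_commute:
  assumes "A \<in> carrier_mat n n" "B \<in> carrier_mat n n"
  shows "mat_trace (A * B) = mat_trace (B * A)"
proof -
  have "mat_trace (A * B) = (\<Sum>i<n. \<Sum>j<n. A $$ (i, j) * B $$ (j, i))"
    using assms by (simp add: mat_trace_def scalar_prod_def atLeast0LessThan)
  also have "\<dots> = (\<Sum>i<n. \<Sum>j<n. B $$ (i, j) * A $$ (j, i))"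
    by (subst sum.swap) (simp add: mult.commute)
  also have "\<dots> = mat_trace (B * A)"
    using assms by (simp add: mat_trace_def scalar_prod_def atLeast0LessThan)
  finally show ?thesis .
qed

text \<open>The trace is invariant under similarity, and the Schur form of \<open>A\<close> has
  diagonal \<open>es\<close>.\<close>

lemma mat_trace_eq_sum_list_roots:
  fixes A :: "real mat"
  assumes A: "A \<in> carrier_mat n n" and "char_poly A = (\<Prod>e\<leftarrow>es. [:- e, 1:])"
  shows "mat_trace A = sum_list es"
proof -
  obtain B P Q where "schur_decomposition A es = (B, P, Q)" by (metis prod_cases3)
  from schur_decomposition[OF A assms(2) this]
  have sim: "similar_mat_wit A B P Q" and es: "diag_mat B = es" by auto
  note S = similar_mat_witD2[OF A sim]
  have "mat_trace A = mat_trace (Q * (P * B))"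
    unfolding S(3) using S(5-7) by (intro mat_trace_mult_commute[of _ n]) auto
  also have "Q * (P * B) = B"
    using S(2,5-7) by (simp flip: assoc_mult_mat[of Q n n P n B n])
  also have "mat_trace B = sum_list es"
    unfolding mat_trace_def es[symmetric] diag_mat_def
    by (simp add: interv_sum_list_conv_sum_set_nat atLeast0LessThan)
  finally show ?thesis .
qed

text \<open>The eigenvector equation is read off in a coordinate where the eigenvector has its
  largest absolute value \<open>M\<close>.\<close>

lemma eigenvalue_le_row_bound:
  fixes A :: "real mat"
  assumes A: "A \<in> carrier_mat n n" and ev: "eigenvalue A e"
    and bound: "\<And>i j. \<lbrakk>i < n; j < n\<rbrakk> \<Longrightarrow> \<bar>A $$ (i, j)\<bar> \<le> c"
  shows "e \<le> real n * c"
proof -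
  obtain v where v: "v \<in> carrier_vec n" "v \<noteq> 0\<^sub>v n" "A *\<^sub>v v = e \<cdot>\<^sub>v v"
    using ev A unfolding eigenvalue_def eigenvector_def by auto
  have "n > 0" using v by (cases n) auto
  define M where "M = Max ((\<lambda>i. \<bar>v $ i\<bar>) ` {..<n})"
  have "M \<in> (\<lambda>i. \<bar>v $ i\<bar>) ` {..<n}" unfolding M_def using \<open>n > 0\<close> by (intro Max_in) auto
  then obtain i where i: "i < n" "M = \<bar>v $ i\<bar>" by auto
  have le: "\<bar>v $ j\<bar> \<le> M" if "j < n" for j unfolding M_def using that by auto
  have "M \<noteq> 0" 
  proof
    assume "M = 0"
    then have "v = 0\<^sub>v n" using v(1) le by (intro eq_vecI) fastforce+
    with v(2) show False ..
  qed
  then have "M > 0" using i by simp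
  have "e * v $ i = (\<Sum>j<n. A $$ (i, j) * v $ j)"
    using arg_cong[OF v(3), of "\<lambda>w. w $ i"] i A v(1) by (simp add: scalar_prod_def atLeast0LessThan)
  then have "e * M \<le> \<bar>\<Sum>j<n. A $$ (i, j) * v $ j\<bar>"
    using i by (metis abs_ge_self abs_mult abs_ge_zero mult_right_mono)
  also have "\<dots> \<le> (\<Sum>j<n. \<bar>A $$ (i, j)\<bar> * \<bar>v $ j\<bar>)"
    by (rule order_trans[OF sum_abs]) (simp add: abs_mult)
  also have "\<dots> \<le> (\<Sum>j<n. c * M)"
    using i(1) by (intro sum_mono mult_mono bound le) (auto intro: order_trans[OF abs_ge_zero bound])
  finally show ?thesis using \<open>M > 0\<close> by simp
qed

text \<open>Schur's triangular form, started with the two eigenvalues \<open>l\<close> and \<open>m\<close>, spans an invariant plane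
  even when \<open>l = m\<close>; symmetry makes the second basis vector an eigenvector after orthogonalization.\<close>

lemma symmetric_orthogonal_eigenvectors:
  fixes A :: "real mat"
  assumes A: "A \<in> carrier_mat n n" and sym: "transpose_mat A = A"
    and cp: "char_poly A = (\<Prod>e\<leftarrow>l # m # es. [:- e, 1:])"
  obtains v w where "v \<in> carrier_vec n" "w \<in> carrier_vec n" "v \<noteq> 0\<^sub>v n" "w \<noteq> 0\<^sub>v n"
    "A *\<^sub>v v = l \<cdot>\<^sub>v v" "A *\<^sub>v w = m \<cdot>\<^sub>v w" "v \<bullet> w = 0"
proof -
  obtain B P Q where "schur_decomposition A (l # m # es) = (B, P, Q)" by (metis prod_cases3)
  from schur_decomposition[OF A cp this]
  have sim: "similar_mat_wit A B P Q" and tri: "upper_triangular B" and diag: "diag_mat B = l # m # es"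
    by auto
  note S = similar_mat_witD2[OF A sim]
  note [simp] = S(1,2,5-7) mult_mat_vec_carrier[OF A] mult_mat_vec_carrier[OF S(5)]
    mult_mat_vec_carrier[OF S(6)] mult_mat_vec_carrier[OF S(7)]
  note dim = carrier_matD[OF S(5)]
  have "length (diag_mat B) = n" using dim by (simp add: diag_mat_def)
  then have n: "n = Suc (Suc (length es))" by (simp add: diag)
  have B00: "B $$ (0, 0) = l" and B11: "B $$ (1, 1) = m"
    using arg_cong[OF diag, of "\<lambda>xs. xs ! 0"] arg_cong[OF diag, of "\<lambda>xs. xs ! 1"] dim n
    by (auto simp: diag_mat_def simp del: upt_Suc)
  define c where "c = B $$ (0, 1)"
  define e0 e1 where "e0 = (unit_vec n 0 :: real vec)" and "e1 = (unit_vec n 1 :: real vec)"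
  have e[simp]: "e0 \<in> carrier_vec n" "e1 \<in> carrier_vec n" by (auto simp: e0_def e1_def)
  \<comment> \<open>Triangularity leaves only \<open>l\<close> in the first column of
    \<open>B\<close>, and only \<open>c\<close> and \<open>m\<close> in the second.\<close>
  have Be0: "B *\<^sub>v e0 = l \<cdot>\<^sub>v e0"
    using dim n B00 upper_triangularD[OF tri, of 0]
    by (intro eq_vecI) (auto simp: e0_def)
  have Be1: "B *\<^sub>v e1 = c \<cdot>\<^sub>v e0 + m \<cdot>\<^sub>v e1"
  proof (rule eq_vecI)
    fix i assume "i < dim_vec (c \<cdot>\<^sub>v e0 + m \<cdot>\<^sub>v e1)"
    then have i: "i < n" by (simp add: e1_def)
    show "(B *\<^sub>v e1) $ i = (c \<cdot>\<^sub>v e0 + m \<cdot>\<^sub>v e1) $ i"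
      using i dim n B11 upper_triangularD[OF tri, of 1 i]
      by (cases "i = 0"; cases "i = 1") (auto simp: e0_def e1_def c_def)
  qed (use dim in \<open>simp add: e1_def\<close>)
  have AP: "A *\<^sub>v (P *\<^sub>v x) = P *\<^sub>v (B *\<^sub>v x)" if [simp]: "x \<in> carrier_vec n" for x
  proof -
    note Px = mult_mat_vec_carrier[OF S(6) that]
    have "(Q * P) *\<^sub>v x = Q *\<^sub>v (P *\<^sub>v x)"
      by (rule assoc_mult_mat_vec[of _ n n _ n]) simp_all
    moreover have "(P * B * Q) *\<^sub>v (P *\<^sub>v x) = (P * B) *\<^sub>v (Q *\<^sub>v (P *\<^sub>v x))"
      by (rule assoc_mult_mat_vec[OF mult_carrier_mat[OF S(6,5)] S(7) Px])
    moreover have "(P * B) *\<^sub>v (Q *\<^sub>v (P *\<^sub>v x)) = P *\<^sub>v (B *\<^sub>v (Q *\<^sub>v (P *\<^sub>v x)))"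
      by (rule assoc_mult_mat_vec[OF S(6,5) mult_mat_vec_carrier[OF S(7) Px]])
    ultimately show ?thesis unfolding S(3) by simp
  qed
  have inj: "x = 0\<^sub>v n" if "P *\<^sub>v x = 0\<^sub>v n" and [simp]: "x \<in> carrier_vec n" for x
  proof -
    have "x = (Q * P) *\<^sub>v x" by simp
    also have "\<dots> = Q *\<^sub>v (P *\<^sub>v x)" by (rule assoc_mult_mat_vec[of _ n n _ n]) simp_all
    also have "\<dots> = 0\<^sub>v n"
      using carrier_matD[OF S(7)] unfolding that(1) by (intro eq_vecI) auto
    finally show ?thesis .
  qed
  define v u where "v = P *\<^sub>v e0" and "u = P *\<^sub>v e1"
  have c[simp]: "v \<in> carrier_vec n" "u \<in> carrier_vec n" by (auto simp: v_def u_def)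
  have Av: "A *\<^sub>v v = l \<cdot>\<^sub>v v"
    by (simp add: v_def AP Be0 mult_mat_vec[of P n n])
  have Au: "A *\<^sub>v u = c \<cdot>\<^sub>v v + m \<cdot>\<^sub>v u"
    by (simp add: v_def u_def AP Be1 mult_mat_vec[of P n n] mult_add_distrib_mat_vec[of P n n])
  have v0: "v \<noteq> 0\<^sub>v n"
  proof
    assume "v = 0\<^sub>v n"
    then have "e0 = 0\<^sub>v n" using inj[OF _ e(1)] by (simp add: v_def)
    then have "e0 $ 0 = 0" using n by simp
    then show False using n by (simp add: e0_def)
  qed
  define t where "t = (v \<bullet> u) / (v \<bullet> v)"
  define w where "w = u + (- t) \<cdot>\<^sub>v v"
  have vv: "v \<bullet> v > 0"
    using conjugate_square_greater_0_vec[OF c(1)] v0 by simp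
  have w[simp]: "w \<in> carrier_vec n" by (simp add: w_def)
  have "w \<noteq> 0\<^sub>v n"
  proof
    assume "w = 0\<^sub>v n"
    moreover have "w = P *\<^sub>v (e1 + (- t) \<cdot>\<^sub>v e0)"
      by (simp add: w_def v_def u_def mult_mat_vec[of P n n] mult_add_distrib_mat_vec[of P n n])
    ultimately have "e1 + (- t) \<cdot>\<^sub>v e0 = 0\<^sub>v n" using inj[of "e1 + (- t) \<cdot>\<^sub>v e0"] by simp
    then have "(e1 + (- t) \<cdot>\<^sub>v e0) $ 1 = 0" using n by simp
    then show False using n by (simp add: e0_def e1_def)
  qed
  have vw: "v \<bullet> w = 0"
    using vv by (simp add: w_def t_def scalar_prod_add_distrib[of _ n] scalar_prod_smult_distrib[of _ n])
  \<comment> \<open>Moving \<open>A\<close> across the scalar product determines \<open>c\<close> as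
    \<open>(l - m) * t\<close>, with \<open>t\<close> the Gram-Schmidt coefficient. This is exactly
    what makes \<open>w\<close> an eigenvector.\<close>
  have "v \<bullet> (A *\<^sub>v u) = (A *\<^sub>v v) \<bullet> u"
    using transpose_vec_mult_scalar[OF A c(2) c(1)] by (simp add: sym)
  then have "c * (v \<bullet> v) = (l - m) * (v \<bullet> u)"
    by (simp add: Av Au scalar_prod_add_distrib[of _ n] scalar_prod_smult_distrib[of _ n]
        smult_scalar_prod_distrib[of _ n] algebra_simps)
  then have ct: "c = (l - m) * t" using vv by (simp add: t_def field_simps)
  have "A *\<^sub>v w = (c \<cdot>\<^sub>v v + m \<cdot>\<^sub>v u) + (- t * l) \<cdot>\<^sub>v v"
    using A by (simp add: w_def Av Au mult_mat_vec[of A n n] mult_add_distrib_mat_vec[of A n n] smult_smult_assoc)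
  also have "\<dots> = m \<cdot>\<^sub>v w"
    by (intro eq_vecI) (simp_all add: carrier_vecD[OF c(1)] carrier_vecD[OF c(2)] w_def ct algebra_simps)
  finally show ?thesis
    using that[of v w] v0 \<open>w \<noteq> 0\<^sub>v n\<close> Av vw by simp
qed

lemma prod_list_map_mset_eq:
  fixes f :: "'a \<Rightarrow> 'b :: comm_monoid_mult"
  shows "mset xs = mset ys \<Longrightarrow> prod_list (map f xs) = prod_list (map f ys)"
  by (metis mset_map prod_mset_prod_list)

lemma mset_Cons_remove1: "x \<in> set xs \<Longrightarrow> mset (x # remove1 x xs) = mset xs"
  by simp

text \<open>Orthogonal eigenvectors to two nonnegative eigenvalues span a plane on which the form is
  nonnegative, and that plane meets the hyperplane of sum zero. So at most one root is nonnegative;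
  trace zero forces one to exist and fixes its value.\<close>

lemma strictly_negative_on_sum_zero_char_poly:
  fixes A :: "real mat"
  assumes A: "A \<in> carrier_mat n n" and n: "0 < n"
    and sym: "\<And>i j. \<lbrakk>i < n; j < n\<rbrakk> \<Longrightarrow> A $$ (i, j) = A $$ (j, i)"
    and trace: "mat_trace A = 0"
    and neg: "\<And>x. \<lbrakk>x \<in> carrier_vec n; x \<noteq> 0\<^sub>v n; (\<Sum>i<n. x $ i) = 0\<rbrakk> \<Longrightarrow> x \<bullet> (A *\<^sub>v x) < 0"
  obtains ms where "\<forall>m\<in>set ms. 0 < m" "length ms = n - 1"
    "char_poly A = (\<Prod>r\<leftarrow>sum_list ms # map uminus ms. [:- r, 1:])"
proof -
  obtain es where cp: "char_poly A = (\<Prod>e\<leftarrow>es. [:- e, 1:])" and len: "length es = n"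
    using char_poly_symmetric_splits[OF A sym] .
  have symA: "transpose_mat A = A" using A sym by (intro eq_matI) auto
  \<comment> \<open>Splitting the multiset covers a repeated eigenvalue \<open>l = m\<close> as
    well.\<close>
  have two: "m < 0" if es: "mset es = mset (l # m # rest)" and "0 \<le> l" for l m rest
  proof (rule ccontr)
    assume "\<not> m < 0"
    have "char_poly A = (\<Prod>e\<leftarrow>l # m # rest. [:- e, 1:])"
      unfolding cp by (rule prod_list_map_mset_eq[OF es])
    then obtain v w where v: "v \<in> carrier_vec n" "v \<noteq> 0\<^sub>v n" "A *\<^sub>v v = l \<cdot>\<^sub>v v"
      and w: "w \<in> carrier_vec n" "w \<noteq> 0\<^sub>v n" "A *\<^sub>v w = m \<cdot>\<^sub>v w" and vw: "v \<bullet> w = 0"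
      using symmetric_orthogonal_eigenvectors[OF A symA] by metis
    have wv: "w \<bullet> v = 0" using vw comm_scalar_prod[OF v(1) w(1)] by simp
    \<comment> \<open>With these coefficients \<open>a v + b w\<close> has coordinate sum zero; if
      \<open>b = 0\<close>, then \<open>v\<close> itself already has.\<close>
    define a b where "a = (\<Sum>i<n. w $ i)" and "b = - (\<Sum>i<n. v $ i)"
    have vv: "0 < v \<bullet> v" and ww: "0 < w \<bullet> w"
      using conjugate_square_greater_0_vec[OF v(1)] conjugate_square_greater_0_vec[OF w(1)] v(2) w(2) by auto
    show False
    proof (cases "b = 0")
      case True
      then have "v \<bullet> (A *\<^sub>v v) < 0" using neg[OF v(1,2)] by (simp add: b_def)
      then show False using vv \<open>0 \<le> l\<close> v by (simp add: mult_less_0_iff)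
    next
      case False
      define x where "x = a \<cdot>\<^sub>v v + b \<cdot>\<^sub>v w"
      have x: "x \<in> carrier_vec n" using v w by (simp add: x_def)
      have "w \<bullet> x = b * (w \<bullet> w)"
        using v(1) w(1) wv by (simp add: x_def scalar_prod_add_distrib[of _ n])
      then have "x \<noteq> 0\<^sub>v n" using False ww w(1) by auto
      moreover have "(\<Sum>i<n. x $ i) = a * (\<Sum>i<n. v $ i) + b * (\<Sum>i<n. w $ i)"
        using v(1) w(1) by (simp add: x_def sum.distrib sum_distrib_left)
      then have "(\<Sum>i<n. x $ i) = 0" by (simp add: a_def b_def)
      ultimately have "x \<bullet> (A *\<^sub>v x) < 0" using neg x by blast
      moreover have "A *\<^sub>v x = (a * l) \<cdot>\<^sub>v v + (b * m) \<cdot>\<^sub>v w"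
        using A v w by (simp add: x_def mult_add_distrib_mat_vec[of A n n] mult_mat_vec[of A n n] smult_smult_assoc)
      then have "x \<bullet> (A *\<^sub>v x) = a\<^sup>2 * l * (v \<bullet> v) + b\<^sup>2 * m * (w \<bullet> w)"
        using v(1) w(1) vw wv x
        by (simp add: x_def scalar_prod_add_distrib[of _ n] add_scalar_prod_distrib[of _ n] power2_eq_square)
      moreover have "0 \<le> a\<^sup>2 * l * (v \<bullet> v)" "0 \<le> b\<^sup>2 * m * (w \<bullet> w)"
        using vv ww \<open>0 \<le> l\<close> \<open>\<not> m < 0\<close> by auto
      ultimately show False by linarith
    qed
  qed
  have sum0: "sum_list es = 0" using mat_trace_eq_sum_list_roots[OF A cp] trace by simp
  have "\<exists>l\<in>set es. 0 \<le> l"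
  proof (rule ccontr)
    assume "\<not> ?thesis"
    then have "\<forall>e\<in>set es. e < 0" by auto
    moreover obtain e es' where "es = e # es'" using len n by (cases es) auto
    moreover from calculation have "sum_list es' \<le> 0" by (intro sum_list_nonpos) auto
    ultimately have "sum_list es < 0" by simp
    then show False using sum0 by simp
  qed
  then obtain l where l: "l \<in> set es" "0 \<le> l" by blast
  define ms where "ms = map uminus (remove1 l es)"
  have uminus_ms: "map uminus ms = remove1 l es" by (simp add: ms_def o_def)
  have perm: "mset es = mset (l # map uminus ms)" using l(1) by (simp add: uminus_ms)
  have pos: "\<forall>m\<in>set ms. 0 < m"
  proof
    fix m assume "m \<in> set ms"
    then have "- m \<in> set (remove1 l es)" by (auto simp: ms_def)
    then have "mset (map uminus ms) = mset ((- m) # remove1 (- m) (map uminus ms))"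
      unfolding uminus_ms by (intro mset_Cons_remove1[symmetric])
    then have "mset es = mset (l # (- m) # remove1 (- m) (map uminus ms))"
      using perm by (simp del: mset_remove1)
    from two[OF this l(2)] show "0 < m" by simp
  qed
  have "sum_list es = l + sum_list (map uminus ms)"
    using perm by (metis sum_mset_sum_list sum_list.Cons)
  then have lsum: "l = sum_list ms" using sum0 uminus_sum_list_map[of "\<lambda>x. x" ms] by (simp add: o_def)
  show ?thesis
  proof (rule that[OF pos])
    show "length ms = n - 1" using l(1) len by (simp add: ms_def length_remove1)
    show "char_poly A = (\<Prod>r\<leftarrow>sum_list ms # map uminus ms. [:- r, 1:])"
      unfolding cp lsum[symmetric] by (rule prod_list_map_mset_eq[OF perm])
  qed
qed

section \<open>The quadratic form of the distance matrix of a tree\<close>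

text \<open>Strict negative type of a distance in the sense of Schoenberg. Weights are functions on
  a set of points rather than vectors, so that points can be added one by one.\<close>

definition strict_negative_type :: "'a set \<Rightarrow> ('a \<Rightarrow> 'a \<Rightarrow> real) \<Rightarrow> bool" where
  "strict_negative_type S \<delta> \<longleftrightarrow> (\<forall>x. (\<Sum>u\<in>S. x u) = 0 \<longrightarrow> (\<exists>u\<in>S. x u \<noteq> 0) \<longrightarrow>
     (\<Sum>u\<in>S. \<Sum>v\<in>S. x u * x v * \<delta> u v) < 0)"

text \<open>On vectors \<open>x\<close> of sum zero, moving the weight of the new leaf \<open>v\<close> to its neighbour \<open>w\<close>
  increases the quadratic form by \<open>2 (x v)\<^sup>2\<close>.\<close>

lemma strict_negative_type_insert_leaf:
  assumes fin: "finite S" and neg: "strict_negative_type S \<delta>"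
    and w: "w \<in> S" and v: "v \<notin> S"
    and sym: "\<And>a b. \<delta> a b = \<delta> b a" and diag: "\<And>a. a \<in> insert v S \<Longrightarrow> \<delta> a a = 0"
    and leaf: "\<And>u. u \<in> S \<Longrightarrow> \<delta> v u = 1 + \<delta> w u"
  shows "strict_negative_type (insert v S) \<delta>"
  unfolding strict_negative_type_def
proof (intro allI impI)
  fix x :: "'a \<Rightarrow> real"
  assume sum0: "(\<Sum>u\<in>insert v S. x u) = 0" and nz: "\<exists>u\<in>insert v S. x u \<noteq> 0"
  define y where "y = (\<lambda>u. x u + (if u = w then x v else 0))"
  define Q where "Q = (\<lambda>f. \<Sum>u\<in>S. \<Sum>t\<in>S. f u * f t * \<delta> u t)"
  define L where "L = (\<Sum>u\<in>S. x u * \<delta> w u)"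
  have sumS: "(\<Sum>u\<in>S. x u) = - x v" using sum0 fin v by simp
  have sumy: "(\<Sum>u\<in>S. y u) = 0"
    using fin w sumS by (simp add: y_def sum.distrib)
  have L': "(\<Sum>u\<in>S. x u * \<delta> u w) = L"
    unfolding L_def by (intro sum.cong refl) (simp add: sym)
  have "Q y = (\<Sum>u\<in>S. \<Sum>t\<in>S. x u * x t * \<delta> u t + (if t = w then x v * (x u * \<delta> u w) else 0)
      + (if u = w then x v * (x t * \<delta> w t) else 0)
      + (if u = w then if t = w then x v * x v * \<delta> w w else 0 else 0))"
    unfolding Q_def y_def by (intro sum.cong refl) (auto simp: algebra_simps)
  also have "\<dots> = Q x + (\<Sum>u\<in>S. x v * (x u * \<delta> u w))
      + (\<Sum>u\<in>S. if u = w then \<Sum>t\<in>S. x v * (x t * \<delta> w t) else 0)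
      + (\<Sum>u\<in>S. if u = w then x v * x v * \<delta> w w else 0)"
    unfolding sum.distrib Q_def
    by (intro arg_cong2[where f = "(+)"] sum.cong refl) (use fin w in auto)
  also have "\<dots> = Q x + x v * L + x v * L + x v * x v * \<delta> w w"
    using fin w by (simp add: L' L_def[symmetric] flip: sum_distrib_left)
  finally have Qy: "Q y = Q x + 2 * x v * L" using diag[of w] w by simp
  have Lv: "(\<Sum>u\<in>S. x u * \<delta> v u) = L - x v"
    by (simp add: leaf L_def algebra_simps sum.distrib sumS)
  have Lv': "(\<Sum>u\<in>S. x u * \<delta> u v) = L - x v"
    unfolding Lv[symmetric] by (intro sum.cong refl) (simp add: sym)
  have "(\<Sum>u\<in>insert v S. \<Sum>t\<in>insert v S. x u * x t * \<delta> u t)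
      = Q x + x v * (\<Sum>u\<in>S. x u * \<delta> v u) + x v * (\<Sum>u\<in>S. x u * \<delta> u v)"
    using fin v diag[of v]
    by (simp add: Q_def sum.distrib sum_distrib_left ac_simps)
  also have "\<dots> = Q y - 2 * (x v)\<^sup>2"
    unfolding Lv Lv' Qy by (simp add: power2_eq_square algebra_simps)
  finally have eq: "(\<Sum>u\<in>insert v S. \<Sum>t\<in>insert v S. x u * x t * \<delta> u t) = Q y - 2 * (x v)\<^sup>2" .
  have neg': "Q y < 0" if "\<exists>u\<in>S. y u \<noteq> 0"
    using neg sumy that unfolding strict_negative_type_def Q_def by blast
  show "(\<Sum>u\<in>insert v S. \<Sum>t\<in>insert v S. x u * x t * \<delta> u t) < 0"
  proof (cases "\<exists>u\<in>S. y u \<noteq> 0")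
    case True
    have "Q y - 2 * (x v)\<^sup>2 < 0" using neg'[OF True] zero_le_power2[of "x v"] by linarith
    then show ?thesis using eq by metis
  next
    \<comment> \<open>Here \<open>Q y\<close> gives nothing and strictness comes from the square: if
      \<open>x v\<close> vanished too, \<open>x\<close> would be zero on all of
      \<open>insert v S\<close>.\<close>
    case False
    then have "Q y = 0" unfolding Q_def by simp
    moreover have "x v \<noteq> 0"
    proof
      assume xv: "x v = 0"
      then have "y = x" unfolding y_def xv by simp
      with False xv nz show False by blast
    qed
    ultimately have "Q y - 2 * (x v)\<^sup>2 < 0" using zero_less_power2[of "x v"] by linarith
    then show ?thesis using eq by metis
  qed
qed

section \<open>Walks, paths and distances\<close>

context graph
begin

text \<open>Loops are cut out: if \<open>u\<close> recurs on the path found so far, only the part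
  after that visit is kept. Thus any walk bounds the distance from above.\<close>

lemma ex_apath_length_le:
  assumes "awalk u p v"
  shows "\<exists>q. apath u q v \<and> length q \<le> length p"
  using assms
proof (induction p arbitrary: u)
  case Nil
  then show ?case by (auto simp: awalk_Nil_iff apath_Nil_iff)
next
  case (Cons e p)
  then have e: "e \<in> arcs G" "tail G e = u" and "awalk (head G e) p v"
    by (auto simp: awalk_Cons_iff)
  then obtain q where q: "apath (head G e) q v" "length q \<le> length p" using Cons.IH by blast
  show ?case
  proof (cases "u \<in> set (awalk_verts (head G e) q)")
    case True
    then obtain q1 q2 where qq: "q = q1 @ q2" "awalk (head G e) q1 u" 
      using q awalk_decomp unfolding apath_def by blast
    then have "apath u q2 v" using q(1) by (auto simp: apath_append_iff)
    then show ?thesis using q(2) qq(1) by force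
  next
    case False
    then have "apath u (e # q) v" using q e by (simp add: apath_Cons_iff)
    then show ?thesis using q(2) by force
  qed
qed

lemma reverse_arc:
  assumes "e \<in> arcs G"
  obtains e' where "e' \<in> arcs G" "tail G e' = head G e" "head G e' = tail G e"
  using sym_arcs assms unfolding symmetric_conv by metis

text \<open>The reversed walk uses opposite arcs supplied by symmetry; recording its vertices
  suffices to transfer distinctness and length.\<close>

lemma ex_reverse_awalk:
  assumes "awalk u p v"
  shows "\<exists>q. awalk v q u \<and> awalk_verts v q = rev (awalk_verts u p)"
  using assms
proof (induction p arbitrary: u)
  case Nil
  then show ?case by (auto simp: awalk_Nil_iff intro!: exI[of _ "[]"])
next
  case (Cons e p)
  then have e: "e \<in> arcs G" "tail G e = u" and w: "awalk (head G e) p v"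
    by (auto simp: awalk_Cons_iff)
  obtain q where q: "awalk v q (head G e)" "awalk_verts v q = rev (awalk_verts (head G e) p)"
    using Cons.IH[OF w] by blast
  obtain e' where e': "e' \<in> arcs G" "tail G e' = head G e" "head G e' = tail G e"
    using reverse_arc[OF e(1)] .
  then have "awalk (head G e) [e'] u" using e by (auto simp: awalk_simps)
  then have "awalk v (q @ [e']) u" using q by (metis awalk_appendI)
  moreover have "awalk_verts v (q @ [e']) = rev (awalk_verts u (e # p))"
    using awalk_verts_append[OF \<open>awalk v (q @ [e']) u\<close>] q(2) e' by simp
  ultimately show ?case by blast
qed

lemma ex_reverse_apath:
  assumes "apath u p v"
  shows "\<exists>q. apath v q u \<and> awalk_verts v q = rev (awalk_verts u p) \<and> length q = length p"
proof -
  obtain q where q: "awalk v q u" "awalk_verts v q = rev (awalk_verts u p)"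
    using ex_reverse_awalk assms unfolding apath_def by blast
  moreover have "length q = length p"
    using arg_cong[OF q(2), of length] by (simp add: length_awalk_verts)
  ultimately show ?thesis using assms unfolding apath_def by auto
qed

lemma path_dist_le: "awalk u p v \<Longrightarrow> path_dist G u v \<le> length p"
proof -
  assume "awalk u p v"
  then obtain q where "apath u q v" "length q \<le> length p" using ex_apath_length_le by blast
  moreover from this(1) have "path_dist G u v \<le> length q"
    unfolding path_dist_def by (intro Least_le) blast
  ultimately show ?thesis by simp
qed

lemma path_dist_attained:
  assumes "u \<rightarrow>\<^sup>* v"
  obtains p where "apath u p v" "length p = path_dist G u v"
proof -
  have "\<exists>l p. apath u p v \<and> length p = l" using assms by (auto simp: reachable_apath)
  from LeastI_ex[OF this] show ?thesis using that unfolding path_dist_def by blast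
qed

lemma path_dist_commute: "path_dist G u v = path_dist G v u"
proof -
  have "(\<exists>p. apath u p v \<and> length p = l) \<longleftrightarrow> (\<exists>p. apath v p u \<and> length p = l)" for l
    using ex_reverse_apath by metis
  then show ?thesis unfolding path_dist_def by simp
qed

lemma path_dist_self: "u \<in> verts G \<Longrightarrow> path_dist G u u = 0"
  using path_dist_le[of u "[]" u] by (simp add: awalk_Nil_iff)

lemma path_dist_le_diameter:
  assumes "u \<rightarrow>\<^sup>* v"
  shows "path_dist G u v \<le> longest_path_diameter G"
proof -
  obtain p where p: "apath u p v" "length p = path_dist G u v" using path_dist_attained[OF assms] .
  \<comment> \<open>Finiteness is what makes the \<open>Max\<close> in the diameter an upper
    bound.\<close>
  have "{length p | u p v. apath u p v} \<subseteq> {..card (verts G)}" using length_apath by auto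
  then have "finite {length p | u p v. apath u p v}" by (rule finite_subset) simp
  then show ?thesis
    unfolding longest_path_diameter_def p(2)[symmetric] using p(1) by (intro Max_ge) auto
qed

section \<open>Growing a tree leaf by leaf\<close>

text \<open>Connectedness of the subgraph induced on \<open>S\<close>, stated with paths of the
  whole graph so that they can be joined to walks leaving \<open>S\<close>.\<close>

definition internally_connected :: "'a set \<Rightarrow> bool" where
  "internally_connected S \<longleftrightarrow>
     (\<forall>a\<in>S. \<forall>b\<in>S. \<exists>p. apath a p b \<and> set (awalk_verts a p) \<subseteq> S)"

lemma internally_connected_insert:
  assumes "internally_connected S" and e: "e \<in> arcs G" "head G e \<in> S" "tail G e \<notin> S"
  shows "internally_connected (insert (tail G e) S)"
proof -
  have 1: "\<exists>p. apath (tail G e) p b \<and> set (awalk_verts (tail G e) p) \<subseteq> insert (tail G e) S"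
    if b: "b \<in> S" for b
  proof -
    obtain p where "apath (head G e) p b" "set (awalk_verts (head G e) p) \<subseteq> S"
      using assms b unfolding internally_connected_def by blast
    then show ?thesis using e by (intro exI[of _ "e # p"]) (auto simp: apath_Cons_iff)
  qed
  then have 2: "\<exists>p. apath b p (tail G e) \<and> set (awalk_verts b p) \<subseteq> insert (tail G e) S"
    if "b \<in> S" for b
    using that ex_reverse_apath by (metis set_rev)
  have 3: "apath (tail G e) [] (tail G e)" using e by (simp add: apath_Nil_iff)
  show ?thesis
    unfolding internally_connected_def
  proof (intro ballI)
    fix a b assume "a \<in> insert (tail G e) S" "b \<in> insert (tail G e) S"
    then consider "a = tail G e" "b = tail G e" | "a = tail G e" "b \<in> S" | "a \<in> S" "b = tail G e"
      | "a \<in> S" "b \<in> S" by blast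
    then show "\<exists>p. apath a p b \<and> set (awalk_verts a p) \<subseteq> insert (tail G e) S"
    proof cases
      case 1
      then show ?thesis using 3 by (intro exI[of _ "[]"]) simp
    next
      case 4
      then show ?thesis using assms(1) unfolding internally_connected_def by blast
    qed (use 1 2 in blast)+
  qed
qed

text \<open>The walk is split at its first vertex in \<open>S\<close>; \<open>butlast\<close> drops
  that vertex \<open>y\<close> itself.\<close>

lemma awalk_first_entry:
  assumes "awalk a q b" "b \<in> S"
  obtains q1 q2 y where "q = q1 @ q2" "awalk a q1 y" "awalk y q2 b" "y \<in> S"
    "set (butlast (awalk_verts a q1)) \<inter> S = {}"
proof -
  have "\<exists>q1 q2 y. q = q1 @ q2 \<and> awalk a q1 y \<and> awalk y q2 b \<and> y \<in> S
    \<and> set (butlast (awalk_verts a q1)) \<inter> S = {}"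
    using assms(1)
  proof (induction q arbitrary: a)
    case Nil
    then show ?case using assms(2) by (auto simp: awalk_Nil_iff)
  next
    case (Cons e q)
    show ?case
    proof (cases "a \<in> S")
      case True
      then show ?thesis
        using Cons.prems
        by (intro exI[of _ "[]"] exI[of _ "e # q"] exI[of _ a]) (auto simp: awalk_simps)
    next
      case False
      from Cons.prems have e: "e \<in> arcs G" "tail G e = a" and w: "awalk (head G e) q b"
        by (auto simp: awalk_Cons_iff)
      obtain q1 q2 y where "q = q1 @ q2" "awalk (head G e) q1 y" "awalk y q2 b" "y \<in> S"
        "set (butlast (awalk_verts (head G e) q1)) \<inter> S = {}"
        using Cons.IH[OF w] by blast
      then show ?thesis
        using False e by (intro exI[of _ "e # q1"] exI[of _ q2] exI[of _ y])
          (auto simp: awalk_Cons_iff)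
    qed
  qed
  then show ?thesis using that by blast
qed

text \<open>A shortest path from \<open>v\<close> to \<open>u\<close> that entered \<open>S\<close> elsewhere than through \<open>w\<close> would close up, inside
  \<open>S\<close> and through the arc from \<open>w\<close> to \<open>v\<close>, to a cycle of length at least 3.\<close>

lemma path_dist_leaf:
  assumes acyc: "\<not> (\<exists>p. cycle p \<and> length p \<ge> 3)"
    and conn: "internally_connected S"
    and e: "e \<in> arcs G" "head G e = w" "tail G e = v" and S: "w \<in> S" "v \<notin> S" "u \<in> S"
  shows "path_dist G v u = 1 + path_dist G w u"
proof (rule antisym)
  have wu: "w \<rightarrow>\<^sup>* u"
    using conn S unfolding internally_connected_def reachable_apath by blast
  obtain p where p: "apath w p u" "length p = path_dist G w u"
    using path_dist_attained[OF wu] .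
  have "awalk v (e # p) u" using e p by (auto simp: awalk_Cons_iff apath_def)
  from path_dist_le[OF this] show "path_dist G v u \<le> 1 + path_dist G w u" by (simp add: p)
next
  obtain p where "apath w p u" using conn S unfolding internally_connected_def by blast
  then have "awalk v (e # p) u" using e by (auto simp: awalk_Cons_iff apath_def)
  then have "v \<rightarrow>\<^sup>* u" by (rule reachable_awalkI)
  then obtain q where q: "apath v q u" "length q = path_dist G v u" using path_dist_attained by blast
  obtain q1 q2 y where y: "q = q1 @ q2" "awalk v q1 y" "awalk y q2 u" "y \<in> S"
    "set (butlast (awalk_verts v q1)) \<inter> S = {}"
    using awalk_first_entry[of v q u S] q(1) S(3) unfolding apath_def by blast
  have "q1 \<noteq> []" using y(2,4) S(2) by (auto simp: awalk_Nil_iff)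
  then obtain f q1' where q1: "q1 = f # q1'" by (cases q1) auto
  have f: "f \<in> arcs G" "tail G f = v" "awalk (head G f) q1' y" using y(2) by (auto simp: q1 awalk_Cons_iff)
  have "length q1 = 1 \<and> y = w"
  proof (rule ccontr)
    assume contr: "\<not> ?thesis"
    \<comment> \<open>The closed walk runs along \<open>q1\<close> from \<open>v\<close> to
      \<open>y\<close>, along \<open>p\<close> inside \<open>S\<close> to \<open>w\<close>, and back
      to \<open>v\<close> by \<open>e'\<close>.\<close>
    obtain p where p: "apath y p w" "set (awalk_verts y p) \<subseteq> S"
      using conn y(4) S(1) unfolding internally_connected_def by blast
    obtain e' where e': "e' \<in> arcs G" "tail G e' = w" "head G e' = v"
      using reverse_arc[OF e(1)] e by metis
    have q1': "distinct (awalk_verts v q1)" 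
      using q(1) y(2) unfolding y(1) apath_append_iff by (auto simp: apath_def)
    have last: "awlast v q1 = y" using y(2) by auto
    have verts1: "awalk_verts (head G f) q1' = butlast (awalk_verts (head G f) q1') @ [y]"
      using append_butlast_last_id[of "awalk_verts (head G f) q1'"] awlast_if_cas f(3)
      by (metis awalkE' awalk_verts_non_Nil)
    have disj: "set (butlast (awalk_verts (head G f) q1')) \<inter> S = {}"
      using y(5) by (auto simp: q1)
    have w1: "awalk v (q1 @ p) w" using y(2) p(1) unfolding apath_def by (metis awalk_appendI)
    have "awalk w [e'] v" using e' S by (auto simp: awalk_simps)
    then have w2: "awalk v ((q1 @ p) @ [e']) v" using w1 by (metis awalk_appendI)
    have "awalk_verts (head G f) (q1' @ p) = butlast (awalk_verts (head G f) q1') @ awalk_verts y p"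
      using w1 awalk_verts_append2[of "head G f" q1' p w] f(3) by (auto simp: q1 awalk_Cons_iff)
    then have "tl (awalk_verts v ((q1 @ p) @ [e']))
        = butlast (awalk_verts (head G f) q1') @ awalk_verts y p @ [v]"
      using awalk_verts_append[OF w2] w1 e' by (auto simp: q1)
    \<comment> \<open>The inner vertices of \<open>q1\<close> avoid \<open>S\<close>, those of
      \<open>p\<close> lie in \<open>S\<close>, and \<open>v\<close> is outside \<open>S\<close> and
      starts the path \<open>q1\<close>.\<close>
    moreover have "distinct \<dots>"
      using q1' p f S(2) disj verts1 unfolding apath_def
      by (auto simp: q1 distinct_butlast dest: in_set_butlastD)
    ultimately have "cycle ((q1 @ p) @ [e'])" using w2 unfolding cycle_def by auto
    \<comment> \<open>Either \<open>q1\<close> has at least two arcs, or it is a single arc ending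
      at some \<open>y\<close> other than \<open>w\<close>, and then \<open>p\<close> is
      nonempty.\<close>
    moreover have "length ((q1 @ p) @ [e']) \<ge> 3"
    proof (cases "length q1 = 1")
      case True
      then have "p \<noteq> []" using contr p(1) by (auto simp: apath_Nil_iff)
      then show ?thesis using True by (cases p) auto
    next
      case False
      then show ?thesis by (auto simp: q1 Suc_le_eq)
    qed
    ultimately show False using acyc by blast
  qed
  then have "path_dist G w u \<le> length q2" "length q1 = 1" using path_dist_le y(3) by auto
  then show "1 + path_dist G w u \<le> path_dist G v u" using q(2) y(1) by simp
qed

text \<open>Induction on the size of an internally connected vertex set, always with the distances
  of the whole tree. For a single vertex the condition is vacuous; acyclicity makes each added
  vertex a leaf.\<close>

lemma tree_path_dist_strict_negative_type:
  assumes acyc: "\<not> (\<exists>p. cycle p \<and> length p \<ge> 3)"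
    and conn: "\<And>u v. \<lbrakk>u \<in> verts G; v \<in> verts G\<rbrakk> \<Longrightarrow> u \<rightarrow>\<^sup>* v"
    and "verts G \<noteq> {}"
  shows "strict_negative_type (verts G) (\<lambda>u v. real (path_dist G u v))"
proof -
  let ?\<delta> = "\<lambda>u v. real (path_dist G u v)"
  have "\<exists>S \<subseteq> verts G. card S = k \<and> internally_connected S \<and> strict_negative_type S ?\<delta>"
    if "1 \<le> k" "k \<le> card (verts G)" for k
    using that
  proof (induction k rule: dec_induct)
    case base
    obtain r where r: "r \<in> verts G" using \<open>verts G \<noteq> {}\<close> by blast
    then have "internally_connected {r}"
      by (auto simp: internally_connected_def apath_Nil_iff intro!: exI[of _ "[]"])
    moreover have "strict_negative_type {r} ?\<delta>" by (simp add: strict_negative_type_def)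
    ultimately show ?case using r by (intro exI[of _ "{r}"]) auto
  next
    case (step k)
    then obtain S where S: "S \<subseteq> verts G" "card S = k" "internally_connected S" "strict_negative_type S ?\<delta>"
      by auto
    have fin: "finite S" using S(1) finite_verts by (rule finite_subset)
    obtain a where a: "a \<in> S" using S(2) step.hyps by fastforce
    obtain b where b: "b \<in> verts G" "b \<notin> S"
      using S(1,2) step.prems by (metis Suc_n_not_le_n subsetI subset_antisym)
    obtain q where "awalk b q a" using conn[of b a] a b S(1) by (auto simp: reachable_awalk)
    then obtain q1 q2 y where y: "awalk b q1 y" "y \<in> S" "set (butlast (awalk_verts b q1)) \<inter> S = {}"
      using awalk_first_entry a by metis
    have "q1 \<noteq> []" using y(1,2) b by (auto simp: awalk_Nil_iff)
    \<comment> \<open>The last arc before the first entry into \<open>S\<close> has its tail outside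
      and its head inside.\<close>
    then obtain q1' e where q1: "q1 = q1' @ [e]" by (cases q1 rule: rev_cases) auto
    have e: "e \<in> arcs G" "head G e \<in> S" using y(1,2) by (auto simp: q1 awalk_simps)
    have "tail G e \<in> set (butlast (awalk_verts b q1))"
      using awalk_verts_conv[of b q1] by (simp add: q1 butlast_append)
    then have t: "tail G e \<notin> S" using y(3) by auto
    let ?S = "insert (tail G e) S"
    have "strict_negative_type ?S ?\<delta>"
      using fin S(4) e(2) t
    proof (rule strict_negative_type_insert_leaf)
      show "?\<delta> x x = 0" if "x \<in> ?S" for x using that S(1) e(1) by (auto intro: path_dist_self)
      show "?\<delta> (tail G e) u = 1 + ?\<delta> (head G e) u" if "u \<in> S" for u
        using path_dist_leaf[OF acyc S(3) e(1) refl refl e(2) t that] by simp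
    qed (simp add: path_dist_commute)
    moreover have "internally_connected ?S" using internally_connected_insert[OF S(3) e t] .
    moreover have "card ?S = Suc k" "?S \<subseteq> verts G" using S(1,2) t fin e(1) by auto
    ultimately show ?case by blast
  qed
  from this[of "card (verts G)"] obtain S where "S \<subseteq> verts G" "card S = card (verts G)"
    "strict_negative_type S ?\<delta>"
    using \<open>verts G \<noteq> {}\<close> by (auto simp: Suc_le_eq card_gt_0_iff)
  then show ?thesis using card_subset_eq[of "verts G" S] by simp
qed

end

section \<open>From the tree to its distance matrix\<close>

lemma distance_char_poly_eq:
  "distance_char_poly T vs = (- 1) ^ length vs * char_poly (distance_matrix T vs)"
proof -
  let ?D = "distance_matrix T vs"
  have D: "?D \<in> carrier_mat (length vs) (length vs)" by (simp add: distance_matrix_def)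
  have "map_mat (\<lambda>a. [:a:]) ?D - [:0, 1:] \<cdot>\<^sub>m 1\<^sub>m (length vs) = (- 1) \<cdot>\<^sub>m char_poly_matrix ?D"
    using D by (intro eq_matI) (auto simp: char_poly_matrix_def)
  moreover have "dim_col (char_poly_matrix ?D) = length vs"
    using char_poly_matrix_closed[OF D] by auto
  ultimately show ?thesis
    by (simp add: distance_char_poly_def char_poly_def det_smult)
qed

lemma abs_dist_coeff: "\<bar>dist_coeff T vs k\<bar> = \<bar>coeff (char_poly (distance_matrix T vs)) k\<bar>"
  by (cases "even (length vs)") (simp_all add: dist_coeff_def distance_char_poly_eq)

text \<open>A vector indexed by positions becomes a weight on vertices through the bijection given
  by the enumeration \<open>vs\<close>.\<close>

lemma distance_matrix_quadratic_form_neg: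
  assumes neg: "strict_negative_type (set vs) (\<lambda>u v. real (path_dist T u v))" and dist: "distinct vs"
    and x: "x \<in> carrier_vec (length vs)" "x \<noteq> 0\<^sub>v (length vs)" "(\<Sum>i<length vs. x $ i) = 0"
  shows "x \<bullet> (distance_matrix T vs *\<^sub>v x) < 0"
proof -
  let ?n = "length vs"
  have bij: "bij_betw ((!) vs) {..<?n} (set vs)" using dist by (intro bij_betw_nth) auto
  define f where "f u = x $ the_inv_into {..<?n} ((!) vs) u" for u
  have f: "f (vs ! i) = x $ i" if "i < ?n" for i
    using the_inv_into_f_f[OF bij_betw_imp_inj_on[OF bij]] that by (simp add: f_def)
  have reindex: "(\<Sum>u\<in>set vs. g u) = (\<Sum>i<?n. g (vs ! i))" for g :: "'a \<Rightarrow> real"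
    by (rule sum.reindex_bij_betw[OF bij, symmetric])
  have "(\<Sum>u\<in>set vs. f u) = 0" unfolding reindex using x(3) by (simp add: f)
  moreover have "\<exists>u\<in>set vs. f u \<noteq> 0"
  proof -
    obtain i where "i < ?n" "x $ i \<noteq> 0" using x(1,2) by (metis carrier_vecD eq_vecI index_zero_vec)
    then show ?thesis using f nth_mem by metis
  qed
  ultimately have "(\<Sum>u\<in>set vs. \<Sum>v\<in>set vs. f u * f v * real (path_dist T u v)) < 0"
    using neg unfolding strict_negative_type_def by blast
  also have "(\<Sum>u\<in>set vs. \<Sum>v\<in>set vs. f u * f v * real (path_dist T u v))
      = x \<bullet> (distance_matrix T vs *\<^sub>v x)"
    using x(1) unfolding reindex
    by (simp add: f scalar_prod_def distance_matrix_def sum_distrib_left atLeast0LessThan ac_simps)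
  finally show ?thesis .
qed

theorem theorem3p6:
  fixes T :: "('a, 'b) pre_digraph" and vs :: "'a list" and n d :: nat
  assumes "undirected_tree T"
    and "n = card (verts T)" and "n \<ge> 3"
    and "d = longest_path_diameter T"
    and "distinct vs" and "set vs = verts T"
  shows "\<forall>k. peak_location (normalized_coeff T vs) (n - 2) k \<longrightarrow>
           \<lfloor>(real n - 2) / (1 + real d)\<rfloor> \<le> int k"
proof -
  let ?D = "distance_matrix T vs"
  from assms(1) interpret graph T by (simp add: undirected_tree_def)
  have acyc: "\<not> (\<exists>p. cycle p \<and> 3 \<le> length p)" using assms(1) by (simp add: undirected_tree_def)
  have reach: "u \<rightarrow>\<^sup>*\<^bsub>T\<^esub> v" if "u \<in> verts T" "v \<in> verts T" for u v
    using assms(1) that reachable_mk_symmetric_eq[OF sym_arcs]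
    unfolding undirected_tree_def connected_def strongly_connected_def by auto
  have len: "length vs = n" using assms(2,5,6) distinct_card by metis
  have D: "?D \<in> carrier_mat n n" by (simp add: distance_matrix_def len)
  have Dij: "?D $$ (i, j) = real (path_dist T (vs ! i) (vs ! j))" if "i < n" "j < n" for i j
    using that by (simp add: distance_matrix_def len)
  have verts: "vs ! i \<in> verts T" if "i < n" for i using that assms(6) len nth_mem by metis
  have "verts T \<noteq> {}" using assms(2,3) by auto
  then have "strict_negative_type (set vs) (\<lambda>u v. real (path_dist T u v))"
    unfolding assms(6) using tree_path_dist_strict_negative_type[OF acyc reach] by blast
  note neg = distance_matrix_quadratic_form_neg[OF this assms(5), unfolded len]
  have sym: "?D $$ (i, j) = ?D $$ (j, i)" if "i < n" "j < n" for i j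
    using that by (simp add: Dij path_dist_commute)
  have trace: "mat_trace ?D = 0"
    using D by (simp add: mat_trace_def Dij path_dist_self verts)
  obtain ms where ms: "\<forall>m\<in>set ms. 0 < m" "length ms = n - 1"
    and cp: "char_poly ?D = (\<Prod>r\<leftarrow>sum_list ms # map uminus ms. [:- r, 1:])"
  proof -
    have "0 < n" using assms(3) by simp
    from strictly_negative_on_sum_zero_char_poly[OF D this sym trace neg] that show ?thesis by blast
  qed
  \<comment> \<open>The positive root is itself an eigenvalue, and all entries are at most
    \<open>d\<close>; this bounds it by \<open>n * d\<close>.\<close>
  have "poly (char_poly ?D) (sum_list ms) = 0" unfolding cp by simp
  then have "eigenvalue ?D (sum_list ms)" using eigenvalue_root_char_poly[OF D] by simp
  from eigenvalue_le_row_bound[OF D this, of "real d"] have bound: "sum_list ms \<le> real n * real d"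
    using path_dist_le_diameter[OF reach[OF verts verts]] by (simp add: Dij assms(4))
  show ?thesis
  proof (intro allI impI)
    fix k assume peak: "peak_location (normalized_coeff T vs) (n - 2) k"
    show "\<lfloor>(real n - 2) / (1 + real d)\<rfloor> \<le> int k"
    proof (rule ccontr)
      assume "\<not> ?thesis"
      then have "real_of_int (int k + 1) \<le> (real n - 2) / (1 + real d)" by linarith
      then have "real ((k + 1) * (d + 1)) \<le> real n - 2" by (simp add: field_simps)
      then have k: "(k + 1) * (d + 1) \<le> n - 2" using assms(3) by linarith
      have "\<bar>coeff (char_poly ?D) k\<bar> < 2 * \<bar>coeff (char_poly ?D) (k + 1)\<bar>"
        using dominant_root_coeff_growth[OF ms(1) refl cp _ assms(3) bound k] ms(2) assms(3) by simp
      \<comment> \<open>The factor \<open>2 ^ k\<close> of the normalization absorbs the 2, so the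
        sequence still rises strictly after \<open>k\<close>.\<close>
      then have "normalized_coeff T vs k < normalized_coeff T vs (k + 1)"
        by (simp add: normalized_coeff_def abs_dist_coeff field_simps)
      moreover have "k + 1 \<le> n - 2" using k by (simp add: algebra_simps)
      ultimately show False using peak unfolding peak_location_def by fastforce
    qed
  qed
qed

end
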